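(* Let $V=\{\text{marked},\text{unmarked}\}$ with the crossing operation $x\mapsto \bar{x}$ that interchanges the two values. On the set $V^4$ of 4-tuples, define the operators $$I(a,b,c,d)=(\bar{b},\,a,\,d,\,\bar{c}),\qquad J(a,b,c,d)=(\bar{c},\,\bar{d},\,a,\,b),\qquad K(a,b,c,d)=(\bar{d},\,c,\,\bar{b},\,a).$$ Then, under composition, $I$, $J$ and $K$ generate an 8-element group of operators on $V^4$ that is isomorphic to the quaternion group $Q_8=\{\pm1,\pm i,\pm j,\pm k\}$.
   Context: In Laws of Form (LoF) an expression takes one of two values, marked or unmarked; crossing $x\mapsto\bar{x}$ (written in LoF by enclosing $x$ in the mark) swaps them, so $\bar{\bar{x}}=x$. Equality of LoF expressions means equality for all values of the variables. The Q-Calculus is the 16-valued system whose values are the 4-tuples $(a,b,c,d)\in V^4$. The operators $I,J,K$ are the "imaginary marks" of the paper with subscripts $i,j,k$. Composition of operators corresponds to nesting of marks ("containment"): enclosing $X$ in the $i$-mark and the result in the $j$-mark means applying $I$ first, then $J$; the product $ij$ corresponds to applying $I$ first and then $J$. $Q_8$ is the usual multiplicative group with $i^2=j^2=k^2=ijk=-1$. *)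

theory Defs
  imports "HOL-Algebra.Generated_Groups"
begin

datatype lof = Marked | Unmarked

fun cross :: "lof \<Rightarrow> lof" where
  "cross Marked = Unmarked"
| "cross Unmarked = Marked"

type_synonym lof4 = "lof \<times> lof \<times> lof \<times> lof"

fun opI :: "lof4 \<Rightarrow> lof4" where
  "opI (a, b, c, d) = (cross b, a, d, cross c)"

fun opJ :: "lof4 \<Rightarrow> lof4" where
  "opJ (a, b, c, d) = (cross c, cross d, a, b)"

fun opK :: "lof4 \<Rightarrow> lof4" where
  "opK (a, b, c, d) = (cross d, c, cross b, a)"

text \<open>Nesting of marks applies the inner operator first, so the product of \<open>f\<close> and \<open>g\<close> is
  \<open>f\<close> followed by \<open>g\<close>: the opposite of the order in \<open>BijGroup\<close>.\<close>

definition op_group :: "(lof4 \<Rightarrow> lof4) monoid" where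
  "op_group = \<lparr>carrier = {f. bij f}, mult = (\<lambda>f g. g \<circ> f), one = id\<rparr>"

definition IJK_group :: "(lof4 \<Rightarrow> lof4) monoid" where
  "IJK_group = op_group\<lparr>carrier := generate op_group {opI, opJ, opK}\<rparr>"

text \<open>The tuple \<open>(a, b, c, d)\<close> stands for the quaternion \<open>a + b i + c j + d k\<close>; the product is
  Hamilton's.\<close>

type_synonym quat = "int \<times> int \<times> int \<times> int"

fun quat_mult :: "quat \<Rightarrow> quat \<Rightarrow> quat" where
  "quat_mult (a1, b1, c1, d1) (a2, b2, c2, d2) =
    (a1 * a2 - b1 * b2 - c1 * c2 - d1 * d2,
     a1 * b2 + b1 * a2 + c1 * d2 - d1 * c2,
     a1 * c2 - b1 * d2 + c1 * a2 + d1 * b2,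
     a1 * d2 + b1 * c2 - c1 * b2 + d1 * a2)"

definition Q8 :: "quat monoid" where
  "Q8 = \<lparr>carrier = {(1, 0, 0, 0), (-1, 0, 0, 0), (0, 1, 0, 0), (0, -1, 0, 0),
                    (0, 0, 1, 0), (0, 0, -1, 0), (0, 0, 0, 1), (0, 0, 0, -1)},
         mult = quat_mult, one = (1, 0, 0, 0)\<rparr>"

lemma cross_cross: "cross (cross x) = x"
  by (cases x) simp_all

lemma group_op_group: "group op_group"
proof (rule groupI)
  fix f assume "f \<in> carrier op_group"
  then have f: "bij f" by (simp add: op_group_def)
  then have "bij (inv_into UNIV f)" "f \<circ> inv_into UNIV f = id"
    by (simp_all add: bij_imp_bij_inv bij_is_surj surj_iff[THEN iffD1])
  then show "\<exists>g\<in>carrier op_group. g \<otimes>\<^bsub>op_group\<^esub> f = \<one>\<^bsub>op_group\<^esub>"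
    by (intro bexI[of _ "inv_into UNIV f"]) (simp_all add: op_group_def)
qed (auto simp: op_group_def bij_comp comp_assoc)

lemma quat_mult_assoc: "quat_mult (quat_mult x y) z = quat_mult x (quat_mult y z)"
  by (cases x; cases y; cases z) (simp add: algebra_simps)

lemma group_Q8: "group Q8"
proof (rule groupI)
  fix x assume "x \<in> carrier Q8"
  then show "\<exists>y\<in>carrier Q8. y \<otimes>\<^bsub>Q8\<^esub> x = \<one>\<^bsub>Q8\<^esub>"
    by (auto simp: Q8_def)
qed (auto simp: Q8_def quat_mult_assoc)

lemma Q8_relations:
  defines "m \<equiv> (-1, 0, 0, 0)" and "i \<equiv> (0, 1, 0, 0)"
    and "j \<equiv> (0, 0, 1, 0)" and "k \<equiv> (0, 0, 0, 1)"
  shows "i \<otimes>\<^bsub>Q8\<^esub> i = m" "j \<otimes>\<^bsub>Q8\<^esub> j = m" "k \<otimes>\<^bsub>Q8\<^esub> k = m"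
    and "i \<otimes>\<^bsub>Q8\<^esub> j \<otimes>\<^bsub>Q8\<^esub> k = m"
  by (simp_all add: Q8_def assms)

end

theory Submission imports Defs begin

text \<open>Read \<open>Unmarked\<close> as \<open>1\<close> and \<open>Marked\<close> as \<open>-1\<close>, so that a 4-tuple becomes a quaternion with
  coordinates \<open>1\<close> or \<open>-1\<close>. Crossing is negation, and \<open>I\<close>, \<open>J\<close>, \<open>K\<close> are then the right
  multiplications by \<open>i\<close>, \<open>j\<close>, \<open>k\<close>. Right multiplication by the elements of \<open>Q8\<close> preserves the set of
  these quaternions, is multiplicative by associativity (first \<open>q\<close>, then \<open>r\<close> gives \<open>q r\<close>) and is
  faithful because a nonzero quaternion can be cancelled. As \<open>i\<close>, \<open>j\<close>, \<open>k\<close> generate \<open>Q8\<close>, the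
  image of this representation is the group generated by \<open>I\<close>, \<open>J\<close>, \<open>K\<close>.\<close>

fun lof_sign :: "lof \<Rightarrow> int" where
  "lof_sign Unmarked = 1"
| "lof_sign Marked = -1"

fun quat_of :: "lof4 \<Rightarrow> quat" where
  "quat_of (a, b, c, d) = (lof_sign a, lof_sign b, lof_sign c, lof_sign d)"

text \<open>Meaningful only when the product again has all coordinates \<plusminus>1; elsewhere
  \<open>inv_into\<close> returns an unspecified value.\<close>

definition op_of :: "quat \<Rightarrow> lof4 \<Rightarrow> lof4" where
  "op_of q v = inv_into UNIV quat_of (quat_mult (quat_of v) q)"

lemma lof_sign_cross [simp]: "lof_sign (cross x) = - lof_sign x"
  by (cases x) simp_all

lemma inj_lof_sign: "inj lof_sign"
proof (rule injI)
  fix x y show "lof_sign x = lof_sign y \<Longrightarrow> x = y"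
    by (cases x; cases y) simp_all
qed

lemma inj_quat_of: "inj quat_of"
  by (rule injI) (auto dest: injD[OF inj_lof_sign])

lemma carrier_Q8:
  "carrier Q8 = {(1, 0, 0, 0), (-1, 0, 0, 0), (0, 1, 0, 0), (0, -1, 0, 0),
    (0, 0, 1, 0), (0, 0, -1, 0), (0, 0, 0, 1), (0, 0, 0, -1)}"
  by (simp add: Q8_def)

lemma mult_Q8: "q \<otimes>\<^bsub>Q8\<^esub> r = quat_mult q r"
  by (simp add: Q8_def)

lemma quat_mult_in_range_quat_of:
  assumes "q \<in> carrier Q8"
  shows "quat_mult (quat_of v) q \<in> range quat_of"
proof -
  obtain a b c d where v: "v = (a, b, c, d)" by (cases v)
  \<comment> \<open>The candidates are the preimages of the products of \<open>v\<close> by 1, -1,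
    i, -i, j, -j, k, -k, in this order.\<close>
  have "quat_mult (quat_of v) q \<in> quat_of `
      {(a, b, c, d), (cross a, cross b, cross c, cross d),
       (cross b, a, d, cross c), (b, cross a, cross d, c),
       (cross c, cross d, a, b), (c, d, cross a, cross b),
       (cross d, c, cross b, a), (d, cross c, b, cross a)}"
    using assms unfolding carrier_Q8 v by (elim insertE emptyE; hypsubst; simp)
  then show ?thesis by blast
qed

lemma quat_of_op_of:
  "q \<in> carrier Q8 \<Longrightarrow> quat_of (op_of q v) = quat_mult (quat_of v) q"
  unfolding op_of_def by (rule f_inv_into_f) (rule quat_mult_in_range_quat_of)

text \<open>The hypothesis itself places each product in the range of \<open>quat_of\<close>, so
  injectivity recovers \<open>f v\<close>.\<close>

lemma op_of_eqI:
  assumes "\<And>v. quat_of (f v) = quat_mult (quat_of v) q"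
  shows "op_of q = f"
  by (rule ext) (simp add: op_of_def assms[symmetric] inv_f_f[OF inj_quat_of])

lemma op_of_basis:
  "op_of (1, 0, 0, 0) = id"
  "op_of (0, 1, 0, 0) = opI" "op_of (0, 0, 1, 0) = opJ" "op_of (0, 0, 0, 1) = opK"
  by (rule op_of_eqI, simp add: split_paired_all)+

lemma op_of_mult:
  assumes "q \<in> carrier Q8" "r \<in> carrier Q8"
  shows "op_of (q \<otimes>\<^bsub>Q8\<^esub> r) = op_of r \<circ> op_of q"
  by (rule op_of_eqI) (simp add: quat_of_op_of assms quat_mult_assoc mult_Q8)

lemma bij_op_of:
  assumes q: "q \<in> carrier Q8"
  shows "bij (op_of q)"
proof -
  interpret group Q8 by (rule group_Q8)
  have one: "op_of \<one>\<^bsub>Q8\<^esub> = id" by (simp add: Q8_def op_of_basis)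
  have "op_of (inv\<^bsub>Q8\<^esub> q) \<circ> op_of q = id" "op_of q \<circ> op_of (inv\<^bsub>Q8\<^esub> q) = id"
    using q by (simp_all add: op_of_mult[symmetric] one)
  then show ?thesis by (rule o_bij)
qed

lemma inj_on_op_of: "inj_on op_of (carrier Q8)"
proof (rule inj_onI)
  fix q r assume qr: "q \<in> carrier Q8" "r \<in> carrier Q8" "op_of q = op_of r"
  \<comment> \<open>This is 1 + i + j + k. Its products by the eight units have distinct sign
    patterns, so this one point separates the operators.\<close>
  let ?u = "(Unmarked, Unmarked, Unmarked, Unmarked)"
  have "quat_mult (quat_of ?u) q = quat_mult (quat_of ?u) r"
    using qr by (metis quat_of_op_of)
  with qr(1,2) show "q = r" by (auto simp: Q8_def)
qed

lemma group_hom_op_of: "group_hom Q8 op_group op_of"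
  by (intro group_hom.intro group_hom_axioms.intro group_Q8 group_op_group homI)
    (simp_all add: op_of_mult bij_op_of, simp_all add: op_group_def bij_op_of)

lemma generate_Q8: "generate Q8 {(0, 1, 0, 0), (0, 0, 1, 0), (0, 0, 0, 1)} = carrier Q8"
    (is "generate Q8 ?S = _")
proof
  show "generate Q8 ?S \<subseteq> carrier Q8"
    by (rule group.generate_incl[OF group_Q8]) (simp add: Q8_def)
  have gen: "q \<in> generate Q8 ?S" if "q \<in> ?S" for q
    using that by (rule generate.incl)
  have mult: "quat_mult q r \<in> generate Q8 ?S"
    if "q \<in> generate Q8 ?S" "r \<in> generate Q8 ?S" for q r
    using generate.eng[OF that] by (simp add: mult_Q8)
  \<comment> \<open>Squaring i gives -1, which then yields -i, -j and -k.\<close>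
  have minus: "(-1, 0, 0, 0) \<in> generate Q8 ?S"
    using mult[OF gen gen, of "(0, 1, 0, 0)" "(0, 1, 0, 0)"] by simp
  have one: "(1, 0, 0, 0) \<in> generate Q8 ?S"
    using generate.one[of Q8 ?S] by (simp add: Q8_def)
  have "(0, -1, 0, 0) \<in> generate Q8 ?S" "(0, 0, -1, 0) \<in> generate Q8 ?S"
    "(0, 0, 0, -1) \<in> generate Q8 ?S"
    using mult[OF minus gen, of "(0, 1, 0, 0)"] mult[OF minus gen, of "(0, 0, 1, 0)"]
      mult[OF minus gen, of "(0, 0, 0, 1)"] by simp_all
  with gen one minus show "carrier Q8 \<subseteq> generate Q8 ?S"
    by (simp add: carrier_Q8)
qed

text \<open>A homomorphism maps the subgroup generated by a set onto the one generated by its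
  image.\<close>

lemma carrier_IJK_group: "carrier IJK_group = op_of ` carrier Q8"
proof -
  interpret group_hom Q8 op_group op_of by (rule group_hom_op_of)
  have "op_of ` {(0, 1, 0, 0), (0, 0, 1, 0), (0, 0, 0, 1)} = {opI, opJ, opK}"
    by (simp add: op_of_basis)
  then show ?thesis
    using generate_img[of "{(0, 1, 0, 0), (0, 0, 1, 0), (0, 0, 0, 1)}"]
    by (simp add: IJK_group_def generate_Q8) (simp add: Q8_def)
qed

lemma op_of_iso: "op_of \<in> iso Q8 IJK_group"
proof (rule isoI)
  have "mult IJK_group = mult op_group" by (simp add: IJK_group_def)
  then show "op_of \<in> hom Q8 IJK_group"
    using group_hom.homh[OF group_hom_op_of] by (simp add: hom_def carrier_IJK_group)
  show "bij_betw op_of (carrier Q8) (carrier IJK_group)"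
    by (simp add: bij_betw_def inj_on_op_of carrier_IJK_group)
qed

theorem theorem1:
  "{opI, opJ, opK} \<subseteq> carrier op_group \<and> group IJK_group \<and> order IJK_group = 8 \<and> IJK_group \<cong> Q8"
proof (intro conjI)
  show IJK: "{opI, opJ, opK} \<subseteq> carrier op_group"
    using bij_op_of[of "(0, 1, 0, 0)"] bij_op_of[of "(0, 0, 1, 0)"] bij_op_of[of "(0, 0, 0, 1)"]
    by (simp add: op_of_basis op_group_def Q8_def)
  show "group IJK_group"
    unfolding IJK_group_def
    by (intro subgroup.subgroup_is_group group.generate_is_subgroup group_op_group IJK)
  have "order IJK_group = card (carrier Q8)"
    by (simp add: order_def carrier_IJK_group card_image inj_on_op_of)
  then show "order IJK_group = 8" by (simp add: Q8_def)
  show "IJK_group \<cong> Q8"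
    using op_of_iso by (intro group.iso_sym[OF group_Q8]) (rule is_isoI)
qed

end
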